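(* Let $\mathfrak{a}_3(\mathbb{C})$ be the $3$-dimensional complex abelian Lie algebra with underlying vector space $\mathbb{C}^3$ and canonical basis $\{e_1,e_2,e_3\}$. Up to isomorphism of hom-Lie algebras, the hom-Lie algebra structures with nilpotent twisting map on $\mathfrak{a}_3(\mathbb{C})$ are exactly the following three: \begin{enumerate} \item $\mathfrak{L}_0^0=(\mathfrak{a}_3(\mathbb{C}),A_0)$ with $A_0$ the zero map; \item $\mathfrak{L}_0^1=(\mathfrak{a}_3(\mathbb{C}),A_1)$ with $A_1e_1=0$, $A_1e_2=0$, $A_1e_3=e_2$; \item $\mathfrak{L}_0^2=(\mathfrak{a}_3(\mathbb{C}),A_2)$ with $A_2e_1=0$, $A_2e_2=e_1$, $A_2e_3=e_2$. \end{enumerate}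
   Context: A complex hom-Lie algebra is a triple $(V,\cdot,A)$, where $V$ is a complex vector space, $\cdot$ is a skew-symmetric bilinear product on $V$, and $A:V\to V$ is a linear map (the twisting map) satisfying the hom-Jacobi identity $$\sum_{\sigma\in S_3}\operatorname{sign}(\sigma)\,Ax_{\sigma(1)}\cdot(x_{\sigma(2)}\cdot x_{\sigma(3)})=0\quad\text{for all }x_1,x_2,x_3\in V.$$ An isomorphism of hom-Lie algebras $(V,\cdot,A)\to(U,\ast,B)$ is an invertible linear map $g:V\to U$ with $g(x\cdot y)=(gx)\ast(gy)$ for all $x,y\in V$ and $g\circ A=B\circ g$. A hom-Lie algebra structure on a Lie algebra $\mathfrak{g}$ is a hom-Lie algebra $(\mathfrak{g},A)$ whose product is the Lie bracket of $\mathfrak{g}$. *)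

theory Defs
  imports "HOL-Analysis.Analysis"
begin

locale complex_algebra = vector_space s
  for s :: "complex \<Rightarrow> 'a::ab_group_add \<Rightarrow> 'a" +
  fixes mult :: "'a \<Rightarrow> 'a \<Rightarrow> 'a"
  assumes linear_mult_left: "Vector_Spaces.linear s s (\<lambda>x. mult x y)"
    and linear_mult_right: "Vector_Spaces.linear s s (\<lambda>y. mult x y)"

locale complex_lie_algebra = complex_algebra +
  assumes alternating: "mult x x = 0"
    and jacobi: "mult x (mult y z) + mult y (mult z x) + mult z (mult x y) = 0"

text \<open>In the hom-Jacobi identity the triple $x_1, x_2, x_3$ is a function on the naturals,
  of which only the values at 1, 2 and 3 occur.\<close>

locale complex_hom_lie_algebra = complex_algebra +
  fixes twist :: "'a \<Rightarrow> 'a"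
  assumes skew: "mult x y = - mult y x"
    and linear_twist: "Vector_Spaces.linear s s twist"
    and hom_jacobi:
      "(\<Sum>\<sigma> | \<sigma> permutes {1::nat, 2, 3}.
          s (of_int (sign \<sigma>)) (mult (twist (v (\<sigma> 1))) (mult (v (\<sigma> 2)) (v (\<sigma> 3))))) = 0"

definition hom_lie_structure_on ::
  "(complex \<Rightarrow> 'a::ab_group_add \<Rightarrow> 'a) \<Rightarrow> ('a \<Rightarrow> 'a \<Rightarrow> 'a) \<Rightarrow> ('a \<Rightarrow> 'a) \<Rightarrow> bool" where
  "hom_lie_structure_on s bracket A \<longleftrightarrow>
     complex_lie_algebra s bracket \<and> complex_hom_lie_algebra s bracket A"

definition hom_lie_isomorphic ::
  "(complex \<Rightarrow> 'a::ab_group_add \<Rightarrow> 'a) \<Rightarrow> ('a \<Rightarrow> 'a \<Rightarrow> 'a) \<Rightarrow> ('a \<Rightarrow> 'a) \<Rightarrow>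
   (complex \<Rightarrow> 'b::ab_group_add \<Rightarrow> 'b) \<Rightarrow> ('b \<Rightarrow> 'b \<Rightarrow> 'b) \<Rightarrow> ('b \<Rightarrow> 'b) \<Rightarrow> bool" where
  "hom_lie_isomorphic s\<^sub>1 m\<^sub>1 A s\<^sub>2 m\<^sub>2 B \<longleftrightarrow>
     (\<exists>g. Vector_Spaces.linear s\<^sub>1 s\<^sub>2 g \<and> bij g \<and>
          (\<forall>x y. g (m\<^sub>1 x y) = m\<^sub>2 (g x) (g y)) \<and> g \<circ> A = B \<circ> g)"

definition nilpotent_map :: "('a::zero \<Rightarrow> 'a) \<Rightarrow> bool" where
  "nilpotent_map A \<longleftrightarrow> (\<exists>n. A ^^ n = (\<lambda>_. 0))"

definition abelian_bracket :: "complex^3 \<Rightarrow> complex^3 \<Rightarrow> complex^3" where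
  "abelian_bracket x y = 0"

abbreviation nilpotent_a3_structure :: "(complex^3 \<Rightarrow> complex^3) \<Rightarrow> bool" where
  "nilpotent_a3_structure A \<equiv> hom_lie_structure_on (*s) abelian_bracket A \<and> nilpotent_map A"

abbreviation a3_isomorphic :: "(complex^3 \<Rightarrow> complex^3) \<Rightarrow> (complex^3 \<Rightarrow> complex^3) \<Rightarrow> bool" where
  "a3_isomorphic A B \<equiv> hom_lie_isomorphic (*s) abelian_bracket A (*s) abelian_bracket B"

definition A\<^sub>0 :: "complex^3 \<Rightarrow> complex^3" where
  "A\<^sub>0 x = 0"

definition A\<^sub>1 :: "complex^3 \<Rightarrow> complex^3" where
  "A\<^sub>1 x = x $ 3 *s axis 2 1"

definition A\<^sub>2 :: "complex^3 \<Rightarrow> complex^3" where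
  "A\<^sub>2 x = x $ 2 *s axis 1 1 + x $ 3 *s axis 2 1"

lemma A\<^sub>1_basis: "A\<^sub>1 (axis 1 1) = 0" "A\<^sub>1 (axis 2 1) = 0" "A\<^sub>1 (axis 3 1) = axis 2 1"
  by (simp_all add: A\<^sub>1_def axis_def)

lemma A\<^sub>2_basis: "A\<^sub>2 (axis 1 1) = 0" "A\<^sub>2 (axis 2 1) = axis 1 1" "A\<^sub>2 (axis 3 1) = axis 2 1"
  by (simp_all add: A\<^sub>2_def axis_def)

end

theory Submission
  imports Defs
begin

text \<open>
  For the zero bracket the hom-Jacobi identity and the compatibility of an isomorphism with the
  products are vacuous, so the statement is the classification of nilpotent endomorphisms of
  \<open>\<complex>\<^sup>3\<close> up to conjugation.  The complete invariant is the nilpotency index, the least \<open>n\<close> with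
  \<open>A\<^sup>n = 0\<close>.

  If \<open>A ^ (k + 1)\<close> kills \<open>w\<close> but \<open>A ^ k\<close> does not, then \<open>w, A w, \<dots>, A\<^sup>k w\<close> are linearly independent
  (\<open>nilpotent_orbit_coefficients_zero\<close>); hence the index is at most 3 (\<open>nilpotent_cube_zero\<close>).
  For index 3 such an orbit is a basis, in which \<open>A\<close> acts as \<open>A\<^sub>2\<close>.  For index 2 an orbit
  \<open>w, A w\<close> leaves one dimension over, and it can be filled by a kernel vector outside the line of
  \<open>A w\<close> (\<open>square_zero_kernel_vector\<close>), which gives \<open>A\<^sub>1\<close>.  Index at most 1 means \<open>A = 0\<close>.
  Each such basis is a conjugating map (\<open>a3_isomorphic_by_basis\<close>).  Conversely, conjugation
  preserves vanishing of powers (\<open>a3_isomorphic_funpow_zero\<close>), so the models, having indices 1, 2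
  and 3, are pairwise non-isomorphic.
\<close>

section \<open>Structures on the abelian algebra as linear maps\<close>

lemma hom_lie_structure_on_abelian_iff:
  "hom_lie_structure_on (*s) abelian_bracket A \<longleftrightarrow> Vector_Spaces.linear (*s) (*s) A"
proof -
  have alg: "complex_algebra (*s) abelian_bracket"
    by unfold_locales (simp_all add: abelian_bracket_def)
  have lie: "complex_lie_algebra (*s) abelian_bracket"
    by (intro complex_lie_algebra.intro alg complex_lie_algebra_axioms.intro)
       (simp_all add: abelian_bracket_def)
  have "complex_hom_lie_algebra (*s) abelian_bracket A \<longleftrightarrow> Vector_Spaces.linear (*s) (*s) A"
    using alg by (simp add: complex_hom_lie_algebra_def complex_hom_lie_algebra_axioms_def
        abelian_bracket_def)
  with lie show ?thesis
    by (simp add: hom_lie_structure_on_def)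
qed

lemma a3_isomorphic_iff:
  "a3_isomorphic A B \<longleftrightarrow> (\<exists>g. Vector_Spaces.linear (*s) (*s) g \<and> bij g \<and> g \<circ> A = B \<circ> g)"
proof -
  have "g (abelian_bracket x y) = abelian_bracket (g x) (g y)"
    if "Vector_Spaces.linear (*s) (*s) g" for g x y
    using vec.linear_0[OF that] by (simp add: abelian_bracket_def)
  then show ?thesis
    unfolding hom_lie_isomorphic_def by blast
qed

text \<open>Conjugate maps have conjugate powers, so the nilpotency index is an isomorphism invariant.\<close>

lemma a3_isomorphic_funpow_zero:
  assumes "a3_isomorphic A B" and An: "A ^^ n = (\<lambda>_. 0)"
  shows "B ^^ n = (\<lambda>_. 0)"
proof
  fix y
  obtain g where g: "Vector_Spaces.linear (*s) (*s) g" "bij g" "g \<circ> A = B \<circ> g"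
    using assms(1) by (auto simp: a3_isomorphic_iff)
  obtain x where x: "y = g x"
    using g(2) by (metis bij_pointE)
  have "(B ^^ m) (g x) = g ((A ^^ m) x)" for m
    using g(3) by (induction m) (simp_all add: fun_eq_iff)
  then show "(B ^^ n) y = 0"
    using An vec.linear_0[OF g(1)] by (simp add: x)
qed

text \<open>
  To identify \<open>A\<close> with a model \<open>B\<close> it suffices to find a basis on which \<open>A\<close> acts as \<open>B\<close> acts on
  the canonical one: the coordinate map of that basis is the isomorphism.
\<close>

lemma a3_isomorphic_by_basis:
  fixes u v w :: "complex^3"
  defines "G \<equiv> \<lambda>x::complex^3. x $ 1 *s u + x $ 2 *s v + x $ 3 *s w"
  assumes indep: "\<And>a b c. a *s u + b *s v + c *s w = 0 \<Longrightarrow> a = 0 \<and> b = 0 \<and> c = 0"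
    and intertwine: "\<And>x. A (G x) = G (B x)"
  shows "a3_isomorphic A B"
proof -
  have lin: "Vector_Spaces.linear (*s) (*s) G"
    by unfold_locales (simp_all add: G_def vec.scale_left_distrib vec.scale_right_distrib)
  have "inj G"
    unfolding vec.linear_inj_iff_eq_0[OF lin]
  proof (intro allI impI)
    fix x assume "G x = 0"
    then have "x $ 1 = 0 \<and> x $ 2 = 0 \<and> x $ 3 = 0"
      unfolding G_def by (rule indep)
    then show "x = 0"
      by (simp add: vec_eq_iff forall_3)
  qed
  then have bij: "bij G"
    using vec.linear_inj_imp_surj[OF lin] by (simp add: bij_def)
  have lin_inv: "Vector_Spaces.linear (*s) (*s) (inv G)"
    using vec.left_inverse_linear[OF lin] \<open>inj G\<close> by (simp add: inj_iff)
  have "inv G (A x) = B (inv G x)" for x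
    using intertwine[of "inv G x"] \<open>inj G\<close> bij_is_surj[OF bij]
    by (simp add: surj_f_inv_f inv_f_eq)
  then show ?thesis
    using lin_inv bij_imp_bij_inv[OF bij] by (auto simp: a3_isomorphic_iff fun_eq_iff)
qed

section \<open>Nilpotent endomorphisms\<close>

text \<open>
  In a vanishing combination of an orbit, let \<open>i\<close> be the first index with a nonzero coefficient.
  Applying \<open>A ^ (k - i)\<close> kills all later terms and leaves a nonzero multiple of \<open>A\<^sup>k w \<noteq> 0\<close>.
\<close>

lemma nilpotent_orbit_coefficients_zero:
  fixes A :: "'a::field^'n \<Rightarrow> 'a^'n"
  assumes lin: "Vector_Spaces.linear (*s) (*s) A"
    and vanish: "(A ^^ Suc k) w = 0" and nonzero: "(A ^^ k) w \<noteq> 0"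
    and comb: "(\<Sum>i\<le>k. c i *s (A ^^ i) w) = 0"
  shows "i \<le> k \<Longrightarrow> c i = 0"
proof (induction i rule: less_induct)
  case (less i)
  interpret A: Vector_Spaces.linear "(*s)" "(*s)" A by (fact lin)
  have pow_linear: "Vector_Spaces.linear (*s) (*s) (A ^^ m)" for m
  proof (induction m)
    case 0
    show ?case using vec.linear_id by (simp add: id_def)
  next
    case (Suc m)
    show ?case using Vector_Spaces.linear_compose[OF Suc lin] by (simp only: funpow.simps)
  qed
  interpret P: Vector_Spaces.linear "(*s)" "(*s)" "A ^^ (k - i)" by (fact pow_linear)
  have high: "(A ^^ m) w = 0" if "k < m" for m
    using that vanish A.zero by (induction m) (auto simp: less_Suc_eq)
  have summand: "c j *s (A ^^ (k - i)) ((A ^^ j) w) = (if j = i then c i *s (A ^^ k) w else 0)"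
    if "j \<le> k" for j
  proof (cases j i rule: linorder_cases)
    case less': less
    then show ?thesis using less.IH[of j] that by simp
  next
    case equal
    then show ?thesis using less.prems by (simp flip: funpow_add[THEN fun_cong, unfolded o_def])
  next
    case greater
    then have "k < (k - i) + j" using less.prems by simp
    from high[OF this] have "(A ^^ (k - i)) ((A ^^ j) w) = 0"
      by (simp add: funpow_add)
    then show ?thesis using greater by simp
  qed
  have "0 = (A ^^ (k - i)) (\<Sum>j\<le>k. c j *s (A ^^ j) w)"
    using comb P.zero by simp
  also have "\<dots> = (\<Sum>j\<le>k. c j *s (A ^^ (k - i)) ((A ^^ j) w))"
    by (simp add: P.sum P.scale)
  also have "\<dots> = (\<Sum>j\<le>k. if j = i then c i *s (A ^^ k) w else 0)"
    by (intro sum.cong) (auto simp: summand)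
  also have "\<dots> = c i *s (A ^^ k) w"
    using less.prems by simp
  finally show ?case
    using nonzero by simp
qed

text \<open>The \<open>k + 1\<close> vectors \<open>w, A w, \<dots>, A\<^sup>k w\<close> are distinct and independent.\<close>

lemma nilpotent_orbit_length:
  fixes A :: "'a::field^'n \<Rightarrow> 'a^'n"
  assumes lin: "Vector_Spaces.linear (*s) (*s) A"
    and vanish: "(A ^^ Suc k) w = 0" and nonzero: "(A ^^ k) w \<noteq> 0"
  shows "k < CARD('n)"
proof -
  let ?f = "\<lambda>i. (A ^^ i) w"
  note coeff = nilpotent_orbit_coefficients_zero[OF assms]
  have inj: "inj_on ?f {..k}"
  proof (rule inj_onI, rule ccontr)
    fix i j assume ij: "i \<in> {..k}" "j \<in> {..k}" "?f i = ?f j" "i \<noteq> j"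
    \<comment> \<open>A repetition is the vanishing combination with coefficients \<open>1\<close> at \<open>i\<close> and \<open>-1\<close> at \<open>j\<close>.\<close>
    let ?c = "\<lambda>l. (if l = i then 1 else 0) - (if l = j then 1 else 0) :: 'a"
    have "(\<Sum>l\<le>k. ?c l *s ?f l)
        = (\<Sum>l\<le>k. (if l = i then ?f i else 0) - (if l = j then ?f j else 0))"
      by (intro sum.cong) (auto simp: vec.scale_left_diff_distrib)
    also have "\<dots> = 0"
      using ij by (simp add: sum_subtractf)
    finally show False
      using coeff[of ?c i] ij by simp
  qed
  have "vec.independent (?f ` {..k})"
  proof (rule vec.independent_if_scalars_zero)
    fix g x assume "(\<Sum>x\<in>?f ` {..k}. g x *s x) = 0" "x \<in> ?f ` {..k}"
    then show "g x = 0"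
      using coeff[of "\<lambda>i. g (?f i)"] by (auto simp: sum.reindex[OF inj])
  qed simp
  then have "card (?f ` {..k}) \<le> CARD('n)"
    using dim_subset_UNIV_cart_gen by (metis vec.dim_eq_card_independent)
  then show ?thesis
    by (simp add: card_image[OF inj])
qed

lemma nilpotent_cube_zero:
  fixes A :: "complex^3 \<Rightarrow> complex^3"
  assumes lin: "Vector_Spaces.linear (*s) (*s) A" and nil: "nilpotent_map A"
  shows "A (A (A x)) = 0"
proof (rule ccontr)
  assume nz: "A (A (A x)) \<noteq> 0"
  define n where "n = (LEAST n. (A ^^ n) x = 0)"
  obtain N where "(A ^^ N) x = 0"
    using nil by (auto simp: nilpotent_map_def fun_eq_iff)
  then have n: "(A ^^ n) x = 0" and below: "\<And>m. m < n \<Longrightarrow> (A ^^ m) x \<noteq> 0"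
    unfolding n_def by (rule LeastI) (metis not_less_Least)
  have zero: "A 0 = 0" using vec.linear_0[OF lin] .
  have "(A ^^ m) x \<noteq> 0" if "m \<le> 3" for m
    using that nz zero by (auto simp: eval_nat_numeral le_Suc_eq)
  then have "3 < n"
    using n by (meson not_le)
  then obtain k where k: "n = Suc k" "3 \<le> k"
    by (cases n) auto
  then show False
    using nilpotent_orbit_length[OF lin, of k x] n below[of k] by simp
qed

text \<open>
  If the kernel were contained in the line of \<open>A w\<close>, then for every \<open>x\<close> the vector \<open>A x\<close>, which
  lies in the kernel, would be some \<open>c\<cdot>A w\<close>; so \<open>x - c\<cdot>w\<close> would lie in the kernel too, and \<open>w\<close>,
  \<open>A w\<close> would span the whole space.
\<close>

lemma square_zero_kernel_vector:
  fixes A :: "complex^3 \<Rightarrow> complex^3"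
  assumes lin: "Vector_Spaces.linear (*s) (*s) A" and sq: "\<And>x. A (A x) = 0"
  obtains u where "A u = 0" "\<And>c. u \<noteq> c *s A w"
proof -
  interpret A: Vector_Spaces.linear "(*s)" "(*s)" A by (fact lin)
  have "\<exists>u. A u = 0 \<and> (\<forall>c. u \<noteq> c *s A w)"
  proof (rule ccontr)
    assume "\<not> ?thesis"
    then have ker: "\<exists>c. u = c *s A w" if "A u = 0" for u
      using that by blast
    have "x \<in> vec.span {w, A w}" for x
    proof -
      obtain c where c: "A x = c *s A w"
        using ker sq by blast
      then have "A (x - c *s w) = 0"
        by (simp add: A.diff A.scale)
      then obtain d where "x - c *s w = d *s A w"
        using ker by blast
      then have "x = c *s w + d *s A w"
        by (simp add: algebra_simps)
      then show ?thesis
        by (simp add: vec.span_add vec.span_scale vec.span_base)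
    qed
    then have "UNIV \<subseteq> vec.span {w, A w}" by blast
    then have "vec.dim (UNIV :: (complex^3) set) \<le> card {w, A w}"
      by (intro vec.dim_le_card) auto
    also have "\<dots> \<le> 2"
      by (simp add: card_insert_if)
    finally show False
      by (simp add: vec_dim_card del: vec.dim_UNIV)
  qed
  then show ?thesis using that by blast
qed

section \<open>The classification\<close>

lemma cube_zero_isomorphic_A\<^sub>2:
  assumes lin: "Vector_Spaces.linear (*s) (*s) A"
    and cube: "\<And>x. A (A (A x)) = 0" and w: "A (A w) \<noteq> 0"
  shows "a3_isomorphic A A\<^sub>2"
proof (rule a3_isomorphic_by_basis[of "A (A w)" "A w" w])
  fix a b c assume comb: "a *s A (A w) + b *s A w + c *s w = 0"
  let ?c = "\<lambda>i::nat. if i = 0 then c else if i = 1 then b else a"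
  have "?c i = 0" if "i \<le> 2" for i
    using nilpotent_orbit_coefficients_zero[OF lin, of 2 w ?c i] that comb w cube
    by (simp add: eval_nat_numeral algebra_simps)
  from this[of 0] this[of 1] this[of 2] show "a = 0 \<and> b = 0 \<and> c = 0"
    by simp
next
  interpret A: Vector_Spaces.linear "(*s)" "(*s)" A by (fact lin)
  show "A (x $ 1 *s A (A w) + x $ 2 *s A w + x $ 3 *s w)
    = A\<^sub>2 x $ 1 *s A (A w) + A\<^sub>2 x $ 2 *s A w + A\<^sub>2 x $ 3 *s w" for x
    by (simp add: A.add A.scale cube A\<^sub>2_def axis_def)
qed

lemma square_zero_isomorphic_A\<^sub>1:
  assumes lin: "Vector_Spaces.linear (*s) (*s) A"
    and sq: "\<And>x. A (A x) = 0" and w: "A w \<noteq> 0"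
  shows "a3_isomorphic A A\<^sub>1"
proof -
  interpret A: Vector_Spaces.linear "(*s)" "(*s)" A by (fact lin)
  obtain u where u: "A u = 0" "\<And>c. u \<noteq> c *s A w"
    using square_zero_kernel_vector[OF lin sq] by blast
  show ?thesis
  proof (rule a3_isomorphic_by_basis[of u "A w" w])
    fix a b c assume comb: "a *s u + b *s A w + c *s w = 0"
    have "A (a *s u + b *s A w + c *s w) = c *s A w"
      by (simp add: A.add A.scale sq u)
    then have c: "c = 0"
      using comb w by simp
    have a: "a = 0"
    proof (rule ccontr)
      assume "a \<noteq> 0"
      have "a *s u = (- b) *s A w"
        using comb c by (simp add: eq_neg_iff_add_eq_0)
      then have "inverse a *s (a *s u) = inverse a *s ((- b) *s A w)"
        by simp
      then have "u = (inverse a * (- b)) *s A w"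
        using \<open>a \<noteq> 0\<close> by simp
      then show False using u(2) by blast
    qed
    show "a = 0 \<and> b = 0 \<and> c = 0"
      using comb a c w by simp
  next
    show "A (x $ 1 *s u + x $ 2 *s A w + x $ 3 *s w)
      = A\<^sub>1 x $ 1 *s u + A\<^sub>1 x $ 2 *s A w + A\<^sub>1 x $ 3 *s w" for x
      by (simp add: A.add A.scale sq u A\<^sub>1_def axis_def)
  qed
qed

lemma A\<^sub>0_funpow: "A\<^sub>0 ^^ 1 = (\<lambda>_. 0)"
  by (simp add: A\<^sub>0_def fun_eq_iff)

lemma A\<^sub>1_funpow: "A\<^sub>1 ^^ 1 \<noteq> (\<lambda>_. 0)" "A\<^sub>1 ^^ 2 = (\<lambda>_. 0)"
proof -
  show "A\<^sub>1 ^^ 1 \<noteq> (\<lambda>_. 0)"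
    using A\<^sub>1_basis(3) by (auto simp: fun_eq_iff intro!: exI[of _ "axis 3 1"])
  show "A\<^sub>1 ^^ 2 = (\<lambda>_. 0)"
    by (simp add: fun_eq_iff eval_nat_numeral A\<^sub>1_def axis_def)
qed

lemma A\<^sub>2_funpow: "A\<^sub>2 ^^ 1 \<noteq> (\<lambda>_. 0)" "A\<^sub>2 ^^ 2 \<noteq> (\<lambda>_. 0)" "A\<^sub>2 ^^ 3 = (\<lambda>_. 0)"
proof -
  show "A\<^sub>2 ^^ 1 \<noteq> (\<lambda>_. 0)" "A\<^sub>2 ^^ 2 \<noteq> (\<lambda>_. 0)"
    using A\<^sub>2_basis
    by (auto simp: fun_eq_iff eval_nat_numeral intro!: exI[of _ "axis 3 1"])
  show "A\<^sub>2 ^^ 3 = (\<lambda>_. 0)"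
    by (simp add: fun_eq_iff eval_nat_numeral A\<^sub>2_def axis_def)
qed

lemma nilpotent_a3_structure_models:
  "nilpotent_a3_structure A\<^sub>0" "nilpotent_a3_structure A\<^sub>1" "nilpotent_a3_structure A\<^sub>2"
proof -
  have "Vector_Spaces.linear (*s) (*s) A\<^sub>0"
    by unfold_locales (simp_all add: A\<^sub>0_def)
  moreover have "Vector_Spaces.linear (*s) (*s) A\<^sub>1"
    by unfold_locales (simp_all add: A\<^sub>1_def vec.scale_left_distrib)
  moreover have "Vector_Spaces.linear (*s) (*s) A\<^sub>2"
    by unfold_locales
       (simp_all add: A\<^sub>2_def algebra_simps)
  moreover have "nilpotent_map A\<^sub>0" "nilpotent_map A\<^sub>1" "nilpotent_map A\<^sub>2"
    unfolding nilpotent_map_def using A\<^sub>0_funpow A\<^sub>1_funpow(2) A\<^sub>2_funpow(3) by blast+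
  ultimately show "nilpotent_a3_structure A\<^sub>0" "nilpotent_a3_structure A\<^sub>1"
      "nilpotent_a3_structure A\<^sub>2"
    by (simp_all add: hom_lie_structure_on_abelian_iff)
qed

lemma nilpotent_a3_structure_isomorphic_model:
  assumes "nilpotent_a3_structure A"
  shows "\<exists>B \<in> {A\<^sub>0, A\<^sub>1, A\<^sub>2}. a3_isomorphic A B"
proof -
  have lin: "Vector_Spaces.linear (*s) (*s) A" and nil: "nilpotent_map A"
    using assms by (simp_all add: hom_lie_structure_on_abelian_iff)
  have cube: "A (A (A x)) = 0" for x
    using nilpotent_cube_zero[OF lin nil] .
  consider "\<And>x. A x = 0" | w where "\<And>x. A (A x) = 0" "A w \<noteq> 0" | w where "A (A w) \<noteq> 0"
    by blast
  then show ?thesis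
  proof cases
    case 1
    then have "A = A\<^sub>0" by (simp add: A\<^sub>0_def fun_eq_iff)
    then have "a3_isomorphic A A\<^sub>0"
      using vec.linear_id unfolding a3_isomorphic_iff by (intro exI[of _ id]) simp
    then show ?thesis by blast
  next
    case 2
    then show ?thesis using square_zero_isomorphic_A\<^sub>1[OF lin] by blast
  next
    case 3
    then show ?thesis using cube_zero_isomorphic_A\<^sub>2[OF lin cube] by blast
  qed
qed

theorem proposition3p1:
  shows "(\<forall>B \<in> {A\<^sub>0, A\<^sub>1, A\<^sub>2}. nilpotent_a3_structure B)
    \<and> (\<forall>A. nilpotent_a3_structure A \<longrightarrow> (\<exists>B \<in> {A\<^sub>0, A\<^sub>1, A\<^sub>2}. a3_isomorphic A B))
    \<and> \<not> a3_isomorphic A\<^sub>0 A\<^sub>1 \<and> \<not> a3_isomorphic A\<^sub>0 A\<^sub>2 \<and> \<not> a3_isomorphic A\<^sub>1 A\<^sub>2"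
proof (intro conjI)
  show "\<forall>B \<in> {A\<^sub>0, A\<^sub>1, A\<^sub>2}. nilpotent_a3_structure B"
    using nilpotent_a3_structure_models by blast
  show "\<forall>A. nilpotent_a3_structure A \<longrightarrow> (\<exists>B \<in> {A\<^sub>0, A\<^sub>1, A\<^sub>2}. a3_isomorphic A B)"
    using nilpotent_a3_structure_isomorphic_model by blast
  show "\<not> a3_isomorphic A\<^sub>0 A\<^sub>1"
    using a3_isomorphic_funpow_zero[OF _ A\<^sub>0_funpow] A\<^sub>1_funpow(1) by blast
  show "\<not> a3_isomorphic A\<^sub>0 A\<^sub>2"
    using a3_isomorphic_funpow_zero[OF _ A\<^sub>0_funpow] A\<^sub>2_funpow(1) by blast
  show "\<not> a3_isomorphic A\<^sub>1 A\<^sub>2"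
    using a3_isomorphic_funpow_zero[OF _ A\<^sub>1_funpow(2)] A\<^sub>2_funpow(2) by blast
qed

end
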